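(* There is $C>0$ such that, for all $\mu$ large enough, $$0<f_{0,\mathrm{per}}-f_0\le C\,e^{-\frac{\pi}{2}\mu}.$$
   Context: For $\mu>0$, the zero-temperature thermodynamic Peierls energy per atom is, for $W\ge0$, $\delta\ge0$, $$g_0(W,\delta)=\frac{\mu}{2}\left((W-1)^2+\delta^2\right)-\frac{4}{\pi}\int_0^{\pi/2}\sqrt{W^2\sin^2(s)+\delta^2\cos^2(s)}\,ds.$$ Set $f_0:=\min\{g_0(W,\delta):\ W\ge0,\ \delta\ge0\}$ (minimum over $2$-periodic configurations) and $f_{0,\mathrm{per}}:=\min\{g_0(W,0):\ W\ge0\}$ (minimum over $1$-periodic configurations). Both depend on $\mu$; the constant $C$ does not. *)

theory Defs
  imports "HOL-Analysis.Analysis"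
begin

definition g\<^sub>0 :: "real \<Rightarrow> real \<Rightarrow> real \<Rightarrow> real" where
  "g\<^sub>0 \<mu> W \<delta> =
     \<mu> / 2 * ((W - 1)\<^sup>2 + \<delta>\<^sup>2)
     - 4 / pi * integral {0..pi/2} (\<lambda>s. sqrt (W\<^sup>2 * (sin s)\<^sup>2 + \<delta>\<^sup>2 * (cos s)\<^sup>2))"

(* The minima are taken with LEAST rather than Inf: the values below are specified
   only if the minimum is attained, so attainment is not presupposed. *)

definition f\<^sub>0 :: "real \<Rightarrow> real" where
  "f\<^sub>0 \<mu> = (LEAST e. e \<in> {g\<^sub>0 \<mu> W \<delta> | W \<delta>. W \<ge> 0 \<and> \<delta> \<ge> 0})"

definition f\<^sub>0_per :: "real \<Rightarrow> real" where
  "f\<^sub>0_per \<mu> = (LEAST e. e \<in> {g\<^sub>0 \<mu> W 0 | W. W \<ge> 0})"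

end

theory Submission
  imports Defs "HOL-Real_Asymp.Real_Asymp"
begin

text \<open>Write \<open>I(W, \<delta>)\<close> for the integral, so that \<open>I(W, 0) = W\<close>. Near \<open>s = 0\<close> the integrand exceeds
  \<open>W * sin s\<close> by at most \<open>\<delta>\<close>, and elsewhere by about \<open>\<delta>\<^sup>2 / (2 * W * s)\<close>. Hence \<open>I(W, \<delta>) - W\<close> is of order
  \<open>\<delta>\<^sup>2 * ln (1 / \<delta>)\<close>, which for small \<open>\<delta>\<close> beats the elastic cost \<open>\<mu> / 2 * \<delta>\<^sup>2\<close> and makes the gap positive.
  Conversely, cutting off at \<open>s = \<eta>\<close> gives
  \<open>I(W, \<delta>) - W \<le> \<delta> * \<eta> + \<delta>\<^sup>2 / (2 * W) * ln (pi / (2 * \<eta>))\<close>, and with \<open>\<eta>\<close> of order \<open>exp (- pi * \<mu> * W / 4)\<close>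
  the gain in energy is of order \<open>\<eta>\<^sup>2\<close>. The cost \<open>\<mu> / 2 * (W - 1)\<^sup>2\<close> forces \<open>W\<close> to be at least
  \<open>1 - 1 / \<mu>\<close> for any gain to be possible, whence the bound \<open>exp (- pi * \<mu> / 2)\<close>.\<close>

section \<open>The integral and explicit antiderivatives\<close>

definition peierls_integral :: "real \<Rightarrow> real \<Rightarrow> real" where
  "peierls_integral W \<delta> =
     integral {0..pi/2} (\<lambda>s. sqrt (W\<^sup>2 * (sin s)\<^sup>2 + \<delta>\<^sup>2 * (cos s)\<^sup>2))"

lemma peierls_integrand_integrable:
  "(\<lambda>s. sqrt (W\<^sup>2 * (sin s)\<^sup>2 + \<delta>\<^sup>2 * (cos s)\<^sup>2)) integrable_on {a..b::real}"
  by (intro integrable_continuous_interval continuous_intros)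

lemma has_integral_sin:
  assumes "a \<le> b"
  shows "((\<lambda>s. c * sin s) has_integral c * (cos a - cos b)) {a..b::real}"
proof -
  have "((\<lambda>s. c * sin s) has_integral (- c * cos b) - (- c * cos a)) {a..b}"
    by (rule fundamental_theorem_of_calculus[OF assms])
       (auto intro!: derivative_eq_intros simp: has_real_derivative_iff_has_vector_derivative[symmetric])
  then show ?thesis by (simp add: algebra_simps)
qed

lemma has_integral_sin_add_inverse:
  assumes "0 < a" "a \<le> b"
  shows "((\<lambda>s. c * sin s + d / s) has_integral c * (cos a - cos b) + d * ln (b / a)) {a..b::real}"
proof -
  have "((\<lambda>s. d / s) has_integral d * ln b - d * ln a) {a..b}"
    by (rule fundamental_theorem_of_calculus[OF assms(2)])
       (use assms in \<open>auto intro!: derivative_eq_intros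
          simp: has_real_derivative_iff_has_vector_derivative[symmetric]\<close>)
  then have "((\<lambda>s. d / s) has_integral d * ln (b / a)) {a..b}"
    using assms by (simp add: ln_div algebra_simps)
  from has_integral_add[OF has_integral_sin[OF assms(2)] this] show ?thesis .
qed

lemma peierls_integral_0_right:
  assumes "W \<ge> 0"
  shows "peierls_integral W 0 = W"
proof -
  have "peierls_integral W 0 = integral {0..pi/2} (\<lambda>s. W * sin s)"
    unfolding peierls_integral_def
  proof (rule integral_cong)
    fix s :: real assume "s \<in> {0..pi/2}"
    then have "sin s \<ge> 0" by (intro sin_ge_zero) auto
    then show "sqrt (W\<^sup>2 * (sin s)\<^sup>2 + 0\<^sup>2 * (cos s)\<^sup>2) = W * sin s"
      using assms by (simp add: real_sqrt_mult)
  qed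
  also have "\<dots> = W"
    using has_integral_sin[of 0 "pi/2" W] by (simp add: integral_unique)
  finally show ?thesis .
qed

section \<open>Upper bounds for the integral\<close>

lemma peierls_integrand_le_add:
  assumes "W \<ge> 0" "\<delta> \<ge> 0" "s \<in> {0..pi/2}"
  shows "sqrt (W\<^sup>2 * (sin s)\<^sup>2 + \<delta>\<^sup>2 * (cos s)\<^sup>2) \<le> W * sin s + \<delta> * cos s"
proof -
  have "sin s \<ge> 0" "cos s \<ge> 0"
    using assms by (auto intro!: sin_ge_zero cos_ge_zero)
  then have "sqrt ((W * sin s)\<^sup>2 + (\<delta> * cos s)\<^sup>2) \<le> W * sin s + \<delta> * cos s"
    using assms by (intro sqrt_sum_squares_le_sum) auto
  then show ?thesis by (simp add: power_mult_distrib)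
qed

text \<open>Crude, but valid down to \<open>W = 0\<close>, where the logarithmic bound degenerates.
  It gives coercivity of the energy and settles small \<open>W\<close>.\<close>

lemma peierls_integral_le_add:
  assumes "W \<ge> 0" "\<delta> \<ge> 0"
  shows "peierls_integral W \<delta> \<le> W + \<delta>"
proof -
  have "((\<lambda>s. W * sin s + \<delta> * cos s) has_integral
          (- W * cos (pi/2) + \<delta> * sin (pi/2)) - (- W * cos 0 + \<delta> * sin 0)) {0..pi/2}"
    by (rule fundamental_theorem_of_calculus)
       (auto intro!: derivative_eq_intros simp: has_real_derivative_iff_has_vector_derivative[symmetric])
  then have I: "((\<lambda>s. W * sin s + \<delta> * cos s) has_integral W + \<delta>) {0..pi/2}"
    by (simp add: algebra_simps)
  show ?thesis
    unfolding peierls_integral_def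
    by (rule has_integral_le[OF integrable_integral[OF peierls_integrand_integrable] I])
       (use peierls_integrand_le_add assms in auto)
qed

text \<open>This is s <= tan s cleared of the division by cos s, so that it includes s = pi/2. It
  lets cos^2 s / sin s be replaced by 1/s, which integrates to a logarithm.\<close>

lemma mult_cos_le_sin:
  assumes "0 \<le> s" "s \<le> pi/2"
  shows "s * cos s \<le> sin s"
proof -
  have "(\<lambda>u. sin u - u * cos u) 0 \<le> (\<lambda>u. sin u - u * cos u) s"
  proof (rule DERIV_nonneg_imp_nondecreasing[OF assms(1)])
    fix x assume x: "0 \<le> x" "x \<le> s"
    have "((\<lambda>u. sin u - u * cos u) has_real_derivative x * sin x) (at x)"
      by (auto intro!: derivative_eq_intros)
    moreover have "x * sin x \<ge> 0"
      using x assms by (intro mult_nonneg_nonneg sin_ge_zero) auto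
    ultimately show "\<exists>y. ((\<lambda>u. sin u - u * cos u) has_real_derivative y) (at x) \<and> 0 \<le> y"
      by blast
  qed
  then show ?thesis by simp
qed

text \<open>This is sqrt (a^2 + b) <= a + b / (2 a) with a = W sin s and b = \<delta>^2 cos^2 s,
  followed by cos^2 s / sin s <= 1/s.\<close>

lemma peierls_integrand_le_inverse:
  assumes "W > 0" "0 < s" "s \<le> pi/2"
  shows "sqrt (W\<^sup>2 * (sin s)\<^sup>2 + \<delta>\<^sup>2 * (cos s)\<^sup>2) \<le> W * sin s + \<delta>\<^sup>2 / (2 * W) / s"
proof (rule real_le_lsqrt)
  have sn: "sin s > 0" and cn: "cos s \<ge> 0"
    using assms by (auto intro!: sin_gt_zero cos_ge_zero)
  then show "0 \<le> W * sin s + \<delta>\<^sup>2 / (2 * W) / s"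
    using assms by simp
  have "s * (cos s)\<^sup>2 \<le> s * cos s"
    using assms cn by (intro mult_left_mono) (simp_all add: power2_eq_square mult_left_le)
  also have "\<dots> \<le> sin s" using assms by (intro mult_cos_le_sin) auto
  finally have "(cos s)\<^sup>2 \<le> sin s / s"
    using assms by (simp add: pos_le_divide_eq mult.commute)
  then have "\<delta>\<^sup>2 * (cos s)\<^sup>2 \<le> \<delta>\<^sup>2 * (sin s / s)"
    by (intro mult_left_mono) auto
  also have "\<dots> = 2 * (W * sin s) * (\<delta>\<^sup>2 / (2 * W) / s)"
    using assms by simp
  finally show "W\<^sup>2 * (sin s)\<^sup>2 + \<delta>\<^sup>2 * (cos s)\<^sup>2 \<le> (W * sin s + \<delta>\<^sup>2 / (2 * W) / s)\<^sup>2"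
    unfolding power2_sum power_mult_distrib[symmetric]
    by (smt (verit) power_mult_distrib zero_le_power2)
qed

text \<open>The coefficient \<open>1 / (2 * W)\<close> of the logarithm is the sharp one; it produces the
  exponent \<open>pi / 2\<close> of the theorem.\<close>

lemma peierls_integral_le_ln:
  assumes "W > 0" "\<delta> \<ge> 0" "0 < \<eta>" "\<eta> \<le> pi/2"
  shows "peierls_integral W \<delta> \<le> W + \<delta> * \<eta> + \<delta>\<^sup>2 / (2 * W) * ln (pi / (2 * \<eta>))"
proof -
  let ?f = "\<lambda>s. sqrt (W\<^sup>2 * (sin s)\<^sup>2 + \<delta>\<^sup>2 * (cos s)\<^sup>2)"
  have "peierls_integral W \<delta> = integral {0..\<eta>} ?f + integral {\<eta>..pi/2} ?f"
    unfolding peierls_integral_def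
    by (rule Henstock_Kurzweil_Integration.integral_combine[symmetric])
       (use assms peierls_integrand_integrable in auto)
  moreover have "integral {0..\<eta>} ?f \<le> W * (1 - cos \<eta>) + \<delta> * \<eta>"
  proof -
    have I: "((\<lambda>s. W * sin s + \<delta>) has_integral W * (1 - cos \<eta>) + \<delta> * \<eta>) {0..\<eta>}"
      using has_integral_add[OF has_integral_sin has_integral_const_real, of 0 \<eta> W \<delta>] assms
      by (simp add: mult.commute)
    show ?thesis
    proof (rule has_integral_le[OF integrable_integral[OF peierls_integrand_integrable] I])
      fix s assume "s \<in> {0..\<eta>}"
      then have "?f s \<le> W * sin s + \<delta> * cos s"
        using assms by (intro peierls_integrand_le_add) auto
      also have "\<dots> \<le> W * sin s + \<delta>"
        using assms by (simp add: mult_left_le)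
      finally show "?f s \<le> W * sin s + \<delta>" .
    qed
  qed
  moreover have "integral {\<eta>..pi/2} ?f \<le> W * cos \<eta> + \<delta>\<^sup>2 / (2 * W) * ln (pi / (2 * \<eta>))"
  proof -
    have I: "((\<lambda>s. W * sin s + \<delta>\<^sup>2 / (2 * W) / s) has_integral
               W * cos \<eta> + \<delta>\<^sup>2 / (2 * W) * ln (pi / (2 * \<eta>))) {\<eta>..pi/2}"
      using has_integral_sin_add_inverse[of \<eta> "pi/2" W "\<delta>\<^sup>2 / (2 * W)"] assms by simp
    show ?thesis
      by (rule has_integral_le[OF integrable_integral[OF peierls_integrand_integrable] I])
         (rule peierls_integrand_le_inverse, use assms in auto)
  qed
  ultimately show ?thesis by (simp add: algebra_simps)
qed

section \<open>Logarithmic lower bound for the integral\<close>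

text \<open>With y the added term, squaring costs 2 W y sin s + y^2 <= (2 W + 1) y s = \<delta>^2 /
  4, by sin s <= s and y <= s; the latter uses \<delta> <= s. Since s <= 1 < pi/3 gives cos s >=
  1/2, this is at most \<delta>^2 cos^2 s. Positivity of the gap needs only some positive
  coefficient, so this one is not sharp.\<close>

lemma peierls_integrand_ge_inverse:
  assumes "W \<ge> 0" "0 < \<delta>" "\<delta> \<le> s" "s \<le> 1"
  shows "W * sin s + \<delta>\<^sup>2 / (4 * (2 * W + 1)) / s \<le> sqrt (W\<^sup>2 * (sin s)\<^sup>2 + \<delta>\<^sup>2 * (cos s)\<^sup>2)"
proof (rule real_le_rsqrt)
  define q where "q = 2 * W + 1"
  define y where "y = \<delta>\<^sup>2 / (4 * q) / s"
  have q: "q \<ge> 1" using assms by (simp add: q_def)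
  have s: "s > 0" using assms by simp
  have y0: "y \<ge> 0" using q s by (simp add: y_def)
  have "cos (pi/3) \<le> cos s"
    using assms pi_gt3 by (intro cos_monotone_0_pi_le) auto
  then have "(1/2)\<^sup>2 \<le> (cos s)\<^sup>2"
    by (intro power_mono) (auto simp: cos_60)
  then have c: "\<delta>\<^sup>2 / 4 \<le> \<delta>\<^sup>2 * (cos s)\<^sup>2"
    using mult_left_mono[of "1/4" "(cos s)\<^sup>2" "\<delta>\<^sup>2"] by (simp add: power_divide)
  have ys: "y * s = \<delta>\<^sup>2 / (4 * q)" using s by (simp add: y_def)
  have "W * sin s * y \<le> W * s * y"
    using assms y0 s by (intro mult_right_mono mult_left_mono sin_x_le_x) auto
  also have "W * s * y = W * (\<delta>\<^sup>2 / (4 * q))" unfolding ys[symmetric] by simp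
  finally have 1: "2 * (W * sin s) * y \<le> 2 * W * (\<delta>\<^sup>2 / (4 * q))" by simp
  have "y \<le> s"
  proof -
    have "\<delta>\<^sup>2 \<le> s\<^sup>2" using assms by (intro power_mono) auto
    also have "\<dots> \<le> s\<^sup>2 * (4 * q)" using q by (simp add: mult_le_cancel_left1)
    finally show ?thesis using s q by (simp add: y_def field_simps power2_eq_square)
  qed
  then have "y\<^sup>2 \<le> y * s" using y0 by (simp add: power2_eq_square mult_left_mono)
  then have "2 * (W * sin s) * y + y\<^sup>2 \<le> 2 * W * (\<delta>\<^sup>2 / (4 * q)) + \<delta>\<^sup>2 / (4 * q)"
    using 1 ys by linarith
  also have "\<dots> = q * (\<delta>\<^sup>2 / (4 * q))" unfolding q_def by (simp only: distrib_right mult_1)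
  also have "\<dots> = \<delta>\<^sup>2 / 4" using q by simp
  finally have "2 * (W * sin s) * y + y\<^sup>2 \<le> \<delta>\<^sup>2 * (cos s)\<^sup>2" using c by linarith
  then have "(W * sin s + y)\<^sup>2 \<le> W\<^sup>2 * (sin s)\<^sup>2 + \<delta>\<^sup>2 * (cos s)\<^sup>2"
    by (simp add: power2_sum power_mult_distrib)
  then show "(W * sin s + \<delta>\<^sup>2 / (4 * (2 * W + 1)) / s)\<^sup>2 \<le> W\<^sup>2 * (sin s)\<^sup>2 + \<delta>\<^sup>2 * (cos s)\<^sup>2"
    by (simp add: y_def q_def)
qed

lemma peierls_integral_ge_ln:
  assumes "W \<ge> 0" "0 < \<delta>" "\<delta> \<le> 1"
  shows "W + \<delta>\<^sup>2 / (4 * (2 * W + 1)) * ln (1 / \<delta>) \<le> peierls_integral W \<delta>"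
proof -
  let ?f = "\<lambda>s. sqrt (W\<^sup>2 * (sin s)\<^sup>2 + \<delta>\<^sup>2 * (cos s)\<^sup>2)"
  have pi2: "1 \<le> pi/2" using pi_gt3 by simp
  have sin_le: "W * sin s \<le> ?f s" for s
    by (rule real_le_rsqrt) (simp add: power_mult_distrib)
  have "peierls_integral W \<delta> = integral {0..\<delta>} ?f + integral {\<delta>..pi/2} ?f"
    unfolding peierls_integral_def
    by (rule Henstock_Kurzweil_Integration.integral_combine[symmetric])
       (use assms pi2 peierls_integrand_integrable in auto)
  moreover have "integral {\<delta>..pi/2} ?f = integral {\<delta>..1} ?f + integral {1..pi/2} ?f"
    by (rule Henstock_Kurzweil_Integration.integral_combine[symmetric])
       (use assms pi2 peierls_integrand_integrable in auto)
  \<comment> \<open>Outside [\<delta>, 1] the trivial bound W sin s is enough; the cosine terms of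
    the three pieces telescope to W.\<close>
  moreover have "W * (cos 0 - cos \<delta>) \<le> integral {0..\<delta>} ?f"
    by (rule has_integral_le[OF has_integral_sin integrable_integral[OF peierls_integrand_integrable]])
       (use assms pi2 sin_le in auto)
  moreover have "W * (cos 1 - cos (pi/2)) \<le> integral {1..pi/2} ?f"
    by (rule has_integral_le[OF has_integral_sin integrable_integral[OF peierls_integrand_integrable]])
       (use assms pi2 sin_le in auto)
  moreover have "W * (cos \<delta> - cos 1) + \<delta>\<^sup>2 / (4 * (2 * W + 1)) * ln (1 / \<delta>) \<le> integral {\<delta>..1} ?f"
    by (rule has_integral_le[OF has_integral_sin_add_inverse[OF assms(2,3)]
          integrable_integral[OF peierls_integrand_integrable]])
       (rule peierls_integrand_ge_inverse, use assms in auto)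
  ultimately show ?thesis by (simp add: algebra_simps)
qed

section \<open>Continuity, and the energy relative to the 1-periodic minimum\<close>

lemma continuous_on_peierls_integral:
  "continuous_on A (\<lambda>p. peierls_integral (fst p) (snd p))"
proof -
  have "continuous_on UNIV (\<lambda>p. integral (cbox 0 (pi/2))
          (\<lambda>s. sqrt ((fst p)\<^sup>2 * (sin s)\<^sup>2 + (snd p)\<^sup>2 * (cos s)\<^sup>2)))"
    by (rule integral_continuous_on_param) (auto simp: split_def intro!: continuous_intros)
  then show ?thesis
    unfolding peierls_integral_def by (auto intro: continuous_on_subset)
qed

lemma g\<^sub>0_eq: "g\<^sub>0 \<mu> W \<delta> = \<mu> / 2 * ((W - 1)\<^sup>2 + \<delta>\<^sup>2) - 4 / pi * peierls_integral W \<delta>"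
  by (simp add: g\<^sub>0_def peierls_integral_def)

text \<open>Splitting the integral as W + (integral - W) leaves a quadratic in W alone. Completing
  its square exhibits the 1-periodic minimiser 1 + 4 / (pi \<mu>) and confines the coupling of W and
  \<delta> to the excess over W.\<close>

lemma g\<^sub>0_complete_square:
  assumes "\<mu> > 0"
  shows "g\<^sub>0 \<mu> W \<delta> = \<mu> / 2 * (W - (1 + 4 / (pi * \<mu>)))\<^sup>2 + \<mu> / 2 * \<delta>\<^sup>2
           - 4 / pi * (peierls_integral W \<delta> - W) - (4 / pi + 8 / (pi\<^sup>2 * \<mu>))"
proof -
  define c where "c = 4 / (pi * \<mu>)"
  have c: "\<mu> * c = 4 / pi" "8 / (pi\<^sup>2 * \<mu>) = \<mu> / 2 * c\<^sup>2"
    using assms by (simp_all add: c_def power2_eq_square)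
  have "\<mu> / 2 * (W - (1 + c))\<^sup>2 = \<mu> / 2 * (W - 1)\<^sup>2 - \<mu> * c * (W - 1) + \<mu> / 2 * c\<^sup>2"
    by (simp add: power2_eq_square field_simps)
  then show ?thesis
    unfolding g\<^sub>0_eq c(2) c_def[symmetric] c(1) distrib_left right_diff_distrib by linarith
qed

lemma f\<^sub>0_per_eq:
  assumes "\<mu> > 0"
  shows "f\<^sub>0_per \<mu> = - (4 / pi + 8 / (pi\<^sup>2 * \<mu>))"
  unfolding f\<^sub>0_per_def
proof (rule Least_equality)
  have eq: "g\<^sub>0 \<mu> W 0 = \<mu> / 2 * (W - (1 + 4 / (pi * \<mu>)))\<^sup>2 - (4 / pi + 8 / (pi\<^sup>2 * \<mu>))"
    if "W \<ge> 0" for W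
    using g\<^sub>0_complete_square[OF assms, of W 0] peierls_integral_0_right[OF that] by simp
  have "1 + 4 / (pi * \<mu>) \<ge> 0" using assms by simp
  moreover from eq[OF this] have "- (4 / pi + 8 / (pi\<^sup>2 * \<mu>)) = g\<^sub>0 \<mu> (1 + 4 / (pi * \<mu>)) 0"
    by simp
  ultimately show "- (4 / pi + 8 / (pi\<^sup>2 * \<mu>)) \<in> {g\<^sub>0 \<mu> W 0 | W. W \<ge> 0}" by blast
  show "- (4 / pi + 8 / (pi\<^sup>2 * \<mu>)) \<le> y" if "y \<in> {g\<^sub>0 \<mu> W 0 | W. W \<ge> 0}" for y
    using that eq assms by auto
qed

lemma g\<^sub>0_minus_f\<^sub>0_per:
  assumes "\<mu> > 0"
  shows "g\<^sub>0 \<mu> W \<delta> - f\<^sub>0_per \<mu> = \<mu> / 2 * (W - (1 + 4 / (pi * \<mu>)))\<^sup>2 + \<mu> / 2 * \<delta>\<^sup>2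
           - 4 / pi * (peierls_integral W \<delta> - W)"
  using g\<^sub>0_complete_square[OF assms] f\<^sub>0_per_eq[OF assms] by simp

section \<open>Existence of a minimiser\<close>

text \<open>\<open>LEAST\<close> is informative only once a minimum exists. On the compact square
  \<open>?K\<close> the minimum is at most the value at (1, 0), which is <= 0; outside, for \<mu> >=
  4, the quadratic term outweighs the linear bound on the integral and the energy is
  nonnegative.\<close>

lemma g\<^sub>0_attains_min:
  assumes "\<mu> \<ge> 4"
  obtains W \<delta> where "W \<ge> 0" "\<delta> \<ge> 0" "\<And>V \<epsilon>. V \<ge> 0 \<Longrightarrow> \<epsilon> \<ge> 0 \<Longrightarrow> g\<^sub>0 \<mu> W \<delta> \<le> g\<^sub>0 \<mu> V \<epsilon>"
proof -
  let ?K = "{0..4::real} \<times> {0..4::real}"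
  have "continuous_on ?K (\<lambda>p. g\<^sub>0 \<mu> (fst p) (snd p))"
    unfolding g\<^sub>0_eq by (intro continuous_intros continuous_on_peierls_integral)
  moreover have "compact ?K" "?K \<noteq> {}" by (auto intro: compact_Times)
  ultimately obtain p where p: "p \<in> ?K"
    and min: "\<And>q. q \<in> ?K \<Longrightarrow> g\<^sub>0 \<mu> (fst p) (snd p) \<le> g\<^sub>0 \<mu> (fst q) (snd q)"
    using continuous_attains_inf[of ?K] by blast
  have "g\<^sub>0 \<mu> 1 0 \<le> 0" by (simp add: g\<^sub>0_eq peierls_integral_0_right)
  then have le0: "g\<^sub>0 \<mu> (fst p) (snd p) \<le> 0" using min[of "(1, 0)"] by simp
  have "g\<^sub>0 \<mu> (fst p) (snd p) \<le> g\<^sub>0 \<mu> V \<epsilon>" if "V \<ge> 0" "\<epsilon> \<ge> 0" for V \<epsilon>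
  proof (cases "V \<le> 4 \<and> \<epsilon> \<le> 4")
    case True
    then show ?thesis using min[of "(V, \<epsilon>)"] that by simp
  next
    case False
    have "4 / pi * peierls_integral V \<epsilon> \<le> 4 / pi * (V + \<epsilon>)"
      using peierls_integral_le_add[OF that] by (intro mult_left_mono) auto
    also have "\<dots> \<le> 2 * (V + \<epsilon>)"
      using that pi_gt3 by (intro mult_right_mono) (auto simp: field_simps)
    finally have "2 * ((V - 1)\<^sup>2 + \<epsilon>\<^sup>2) - 2 * (V + \<epsilon>) \<le> g\<^sub>0 \<mu> V \<epsilon>"
      using mult_right_mono[of 2 "\<mu>/2" "(V - 1)\<^sup>2 + \<epsilon>\<^sup>2"] assms by (simp add: g\<^sub>0_eq)
    moreover have "0 \<le> 2 * ((V - 1)\<^sup>2 + \<epsilon>\<^sup>2) - 2 * (V + \<epsilon>)"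
    proof -
      have eq: "2 * ((V - 1)\<^sup>2 + \<epsilon>\<^sup>2) - 2 * (V + \<epsilon>) = 2 * (V - 3/2)\<^sup>2 + 2 * (\<epsilon> - 1/2)\<^sup>2 - 3"
        by (simp add: power2_eq_square algebra_simps)
      \<comment> \<open>One coordinate exceeds 4, so one of the squares is at least 25/4, and 2 *
        25/4 > 3.\<close>
      have "(5/2)\<^sup>2 \<le> (V - 3/2)\<^sup>2 \<or> (5/2)\<^sup>2 \<le> (\<epsilon> - 1/2)\<^sup>2"
        using False by (smt (verit) power_mono field_sum_of_halves)
      then have "25/4 \<le> (V - 3/2)\<^sup>2 \<or> 25/4 \<le> (\<epsilon> - 1/2)\<^sup>2"
        by (simp add: power_divide)
      moreover have "(V - 3/2)\<^sup>2 \<ge> 0" "(\<epsilon> - 1/2)\<^sup>2 \<ge> 0" by simp_all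
      ultimately show ?thesis unfolding eq by (elim disjE) linarith+
    qed
    ultimately show ?thesis using le0 by linarith
  qed
  then show thesis using that[of "fst p" "snd p"] p by auto
qed

lemma f\<^sub>0_attained:
  assumes "\<mu> \<ge> 4"
  obtains W \<delta> where "W \<ge> 0" "\<delta> \<ge> 0" "f\<^sub>0 \<mu> = g\<^sub>0 \<mu> W \<delta>"
    "\<And>V \<epsilon>. V \<ge> 0 \<Longrightarrow> \<epsilon> \<ge> 0 \<Longrightarrow> f\<^sub>0 \<mu> \<le> g\<^sub>0 \<mu> V \<epsilon>"
proof -
  obtain W \<delta> where W: "W \<ge> 0" "\<delta> \<ge> 0"
    and min: "\<And>V \<epsilon>. V \<ge> 0 \<Longrightarrow> \<epsilon> \<ge> 0 \<Longrightarrow> g\<^sub>0 \<mu> W \<delta> \<le> g\<^sub>0 \<mu> V \<epsilon>"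
    using g\<^sub>0_attains_min[OF assms] by blast
  have "f\<^sub>0 \<mu> = g\<^sub>0 \<mu> W \<delta>"
    unfolding f\<^sub>0_def by (rule Least_equality) (use W min in auto)
  then show thesis using that W min by simp
qed

section \<open>The two bounds for the energy gap\<close>

lemma exists_g\<^sub>0_less_f\<^sub>0_per:
  assumes "\<mu> > 0"
  shows "\<exists>W\<ge>0. \<exists>\<delta>\<ge>0. g\<^sub>0 \<mu> W \<delta> < f\<^sub>0_per \<mu>"
proof -
  \<comment> \<open>At the 1-periodic minimiser the square in W vanishes. \<open>M\<close> is chosen
    so that the logarithmic gain is at least \<mu> \<delta>^2, twice the elastic cost of
    \<delta>.\<close>
  define W where "W = 1 + 4 / (pi * \<mu>)"
  define M where "M = pi * \<mu> * (2 * W + 1)"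
  define \<delta> where "\<delta> = exp (- M)"
  have W: "W \<ge> 0" using assms by (simp add: W_def)
  then have M: "M \<ge> 0" using assms by (simp add: M_def)
  have "W + \<delta>\<^sup>2 / (4 * (2 * W + 1)) * ln (1 / \<delta>) \<le> peierls_integral W \<delta>"
    using W M by (intro peierls_integral_ge_ln) (auto simp: \<delta>_def)
  also have "\<delta>\<^sup>2 / (4 * (2 * W + 1)) * ln (1 / \<delta>) = \<delta>\<^sup>2 * (pi * \<mu> / 4)"
  proof -
    have "2 * W + 1 > 0" using W by simp
    then have "a / (4 * (2 * W + 1)) * (pi * \<mu> * (2 * W + 1)) = a * (pi * \<mu> / 4)" for a
      by (simp add: divide_simps)
    moreover have "ln (1 / \<delta>) = pi * \<mu> * (2 * W + 1)" by (simp add: \<delta>_def M_def ln_div)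
    ultimately show ?thesis by simp
  qed
  finally have "4 / pi * (\<delta>\<^sup>2 * (pi * \<mu> / 4)) \<le> 4 / pi * (peierls_integral W \<delta> - W)"
    by (intro mult_left_mono) auto
  then have "\<mu> * \<delta>\<^sup>2 \<le> 4 / pi * (peierls_integral W \<delta> - W)" by (simp add: mult.commute)
  moreover have "\<mu> * \<delta>\<^sup>2 > 0" using assms by (simp add: \<delta>_def)
  moreover have "g\<^sub>0 \<mu> W \<delta> - f\<^sub>0_per \<mu> = \<mu> * \<delta>\<^sup>2 / 2 - 4 / pi * (peierls_integral W \<delta> - W)"
    using g\<^sub>0_minus_f\<^sub>0_per[OF assms, of W \<delta>] by (simp add: W_def)
  ultimately have "g\<^sub>0 \<mu> W \<delta> < f\<^sub>0_per \<mu>" by linarith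
  moreover have "\<delta> \<ge> 0" by (simp add: \<delta>_def)
  ultimately show ?thesis using W by blast
qed

text \<open>Optimising over \<delta> removes it from the estimate and leaves a one-variable
  comparison in W.\<close>

lemma g\<^sub>0_ge_f\<^sub>0_per_minus_exp:
  assumes "\<mu> > 0" "\<delta> \<ge> 0" "W \<ge> 4 / (pi * \<mu>)"
  shows "g\<^sub>0 \<mu> W \<delta> - f\<^sub>0_per \<mu> \<ge>
           \<mu> / 2 * (W - (1 + 4 / (pi * \<mu>)))\<^sup>2 - pi * exp 2 / 2 * (W * exp (- (pi / 2) * \<mu> * W))"
proof -
  \<comment> \<open>The cut-off is tuned so that the logarithm cancels \<open>\<mu> / 2 * \<delta>\<^sup>2\<close> up to the positive
     remainder \<open>2 / (pi * W) * \<delta>\<^sup>2\<close>, which absorbs the term linear in \<open>\<delta>\<close>.\<close>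
  define \<eta> where "\<eta> = pi / 2 * exp (1 - pi * \<mu> * W / 4)"
  have W: "W > 0" using assms by (smt (verit) divide_pos_pos mult_pos_pos pi_gt_zero)
  \<comment> \<open>The lower bound on W says exactly that the cut-off does not exceed pi/2.\<close>
  have "1 - pi * \<mu> * W / 4 \<le> 0" using assms by (simp add: field_simps)
  then have \<eta>: "0 < \<eta>" "\<eta> \<le> pi/2" by (auto simp: \<eta>_def mult_le_cancel_left1)
  have "pi / (2 * \<eta>) = exp (pi * \<mu> * W / 4 - 1)"
    by (simp add: \<eta>_def exp_diff)
  then have ln: "ln (pi / (2 * \<eta>)) = pi * \<mu> * W / 4 - 1" by simp
  have \<eta>2: "\<eta>\<^sup>2 = pi\<^sup>2 / 4 * (exp 2 * exp (- (pi / 2) * \<mu> * W))"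
  proof -
    have "(exp (1 - pi * \<mu> * W / 4))\<^sup>2 = exp 2 * exp (- (pi / 2) * \<mu> * W)"
      by (simp add: power2_eq_square exp_add[symmetric])
    then show ?thesis by (simp add: \<eta>_def power_mult_distrib power_divide)
  qed
  have "4 / pi * (peierls_integral W \<delta> - W)
          \<le> 4 / pi * (\<delta> * \<eta> + \<delta>\<^sup>2 / (2 * W) * (pi * \<mu> * W / 4 - 1))"
    using peierls_integral_le_ln[OF W assms(2) \<eta>] ln by (intro mult_left_mono) auto
  also have "\<dots> = \<mu> / 2 * \<delta>\<^sup>2 + 4 / pi * \<eta> * \<delta> - 2 / (pi * W) * \<delta>\<^sup>2"
    using W by (simp add: field_simps)
  \<comment> \<open>Completing the square in \<delta>: the worst case is \<delta> = W
    \<eta>.\<close>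
  also have "\<dots> = \<mu> / 2 * \<delta>\<^sup>2 + 2 * W / pi * \<eta>\<^sup>2 - 2 / (pi * W) * (\<delta> - W * \<eta>)\<^sup>2"
    using W by (simp add: field_simps power2_eq_square)
  also have "\<dots> \<le> \<mu> / 2 * \<delta>\<^sup>2 + 2 * W / pi * \<eta>\<^sup>2"
    using W by simp
  also have "2 * W / pi * \<eta>\<^sup>2 = pi * exp 2 / 2 * (W * exp (- (pi / 2) * \<mu> * W))"
    unfolding \<eta>2 by (simp add: power2_eq_square)
  finally show ?thesis using g\<^sub>0_minus_f\<^sub>0_per[OF assms(1), of W \<delta>] by linarith
qed

text \<open>The elastic penalty \<open>?S\<close> competes with the gain \<open>?X\<close>. Away
  from W = 1 on the left the penalty wins outright; otherwise \<open>?X\<close> itself has the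
  claimed order. Assumption \<open>small\<close> handles the intermediate range.\<close>

lemma f\<^sub>0_per_minus_g\<^sub>0_le:
  assumes \<mu>: "\<mu> \<ge> 8" and small: "pi * exp 2 / 2 * exp (- (pi / 4) * \<mu>) \<le> 1 / (2 * \<mu>)"
    and "W \<ge> 0" "\<delta> \<ge> 0"
  shows "f\<^sub>0_per \<mu> - g\<^sub>0 \<mu> W \<delta> \<le> pi * exp 4 / 2 * exp (- (pi / 2) * \<mu>)"
proof -
  let ?K = "pi * exp 2 / 2"
  let ?X = "?K * (W * exp (- (pi / 2) * \<mu> * W))"
  let ?S = "\<mu> / 2 * (W - (1 + 4 / (pi * \<mu>)))\<^sup>2"
  have pos: "0 \<le> pi * exp 4 / 2 * exp (- (pi / 2) * \<mu>)" by simp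
  \<comment> \<open>One factor exp 2 comes from the shift by 1 in the cut-off, the other from moving
    W to 1 in the exponent.\<close>
  have K: "?K * exp 2 = pi * exp 4 / 2" by (simp add: exp_add[symmetric])
  have sq: "\<mu> / 2 * (1 - W)\<^sup>2 \<le> ?S" if "W \<le> 1"
  proof -
    have "(1 - W)\<^sup>2 \<le> (1 + 4 / (pi * \<mu>) - W)\<^sup>2"
      using that \<mu> by (intro power_mono) auto
    then show ?thesis using \<mu> by (simp add: power2_commute)
  qed
  have "3 * 8 \<le> pi * \<mu>" using \<mu> pi_gt3 by (intro mult_mono) auto
  then have cutoff: "4 / (pi * \<mu>) \<le> 1/2" by (simp add: field_simps)
  have bound: ?thesis
    if "1/2 \<le> W" "W * exp (- (pi / 2) * \<mu> * W) \<le> exp 2 * exp (- (pi / 2) * \<mu>)"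
  proof -
    have "?X \<le> ?K * (exp 2 * exp (- (pi / 2) * \<mu>))"
      using that(2) by (intro mult_left_mono) auto
    also have "\<dots> = pi * exp 4 / 2 * exp (- (pi / 2) * \<mu>)" unfolding K[symmetric] by simp
    finally have X: "?X \<le> pi * exp 4 / 2 * exp (- (pi / 2) * \<mu>)" .
    have "0 \<le> ?S" using \<mu> by simp
    moreover have "?S - ?X \<le> g\<^sub>0 \<mu> W \<delta> - f\<^sub>0_per \<mu>"
    proof (rule g\<^sub>0_ge_f\<^sub>0_per_minus_exp)
      show "4 / (pi * \<mu>) \<le> W" using that(1) cutoff by linarith
    qed (use \<mu> assms(4) in auto)
    ultimately show ?thesis using X by linarith
  qed
  consider "W \<le> 1/2" | "1/2 \<le> W" "W \<le> 1 - 1 / \<mu>" | "1 - 1 / \<mu> \<le> W" "W \<le> 1" "1/2 \<le> W" | "1 \<le> W"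
    by linarith
  then show ?thesis
  proof cases
    case 1
    have "(1/2)\<^sup>2 \<le> (1 - W)\<^sup>2" using 1 by (intro power_mono) auto
    then have "1 \<le> \<mu> / 2 * (1 - W)\<^sup>2"
      using mult_mono[of 4 "\<mu>/2" "1/4" "(1 - W)\<^sup>2"] \<mu> by (simp add: power_divide)
    then have S: "1 \<le> ?S" using sq 1 by simp
    have "4 / pi * (peierls_integral W \<delta> - W) \<le> 4 / pi * \<delta>"
      using peierls_integral_le_add[OF assms(3,4)] by (intro mult_left_mono) auto
    also have "\<dots> \<le> 2 * \<delta>"
      using assms pi_gt3 by (intro mult_right_mono) (auto simp: field_simps)
    also have "2 * \<delta> \<le> 1 + \<delta>\<^sup>2" using zero_le_power2[of "\<delta> - 1"] by (simp add: power2_diff)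
    also have "\<delta>\<^sup>2 \<le> \<mu> / 2 * \<delta>\<^sup>2" using mult_right_mono[of 1 "\<mu> / 2" "\<delta>\<^sup>2"] \<mu> by simp
    finally have "0 \<le> g\<^sub>0 \<mu> W \<delta> - f\<^sub>0_per \<mu>"
      using g\<^sub>0_minus_f\<^sub>0_per[of \<mu> W \<delta>] \<mu> S by linarith
    then show ?thesis using pos by linarith
  next
    case 2
    have "1 / \<mu> \<ge> 0" using \<mu> by simp
    then have W1: "W \<le> 1" using 2 by linarith
    \<comment> \<open>W >= 1/2 yields only half the target exponent, but the penalty is at least 1 /
      (2 \<mu>), which already exceeds this.\<close>
    have "pi * \<mu> * (1/2) \<le> pi * \<mu> * W" using 2 \<mu> by (intro mult_left_mono) auto
    then have ex: "- (pi / 2) * \<mu> * W \<le> - (pi / 4) * \<mu>" by simp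
    have "?X \<le> ?K * (1 * exp (- (pi / 4) * \<mu>))"
      using W1 ex by (intro mult_left_mono mult_mono) simp_all
    also have "\<dots> \<le> 1 / (2 * \<mu>)" using small by simp
    also have "\<dots> = \<mu> / 2 * (1 / \<mu>)\<^sup>2" using \<mu> by (simp add: power2_eq_square)
    also have "\<dots> \<le> \<mu> / 2 * (1 - W)\<^sup>2"
      using 2 \<mu> by (intro mult_left_mono power_mono) auto
    also have "\<dots> \<le> ?S" using sq W1 by simp
    finally have "?X \<le> ?S" .
    moreover have "4 / (pi * \<mu>) \<le> W" using cutoff 2 by linarith
    ultimately show ?thesis
      using g\<^sub>0_ge_f\<^sub>0_per_minus_exp[of \<mu> \<delta> W] assms pos by linarith
  next
    case 3
    \<comment> \<open>Within 1 / \<mu> of 1, replacing W by 1 in the exponent changes it by at most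
      pi/2 < 2.\<close>
    have "\<mu> * (1 - W) \<le> 1" using 3 \<mu> by (simp add: field_simps)
    then have "pi / 2 * (\<mu> * (1 - W)) \<le> 2 * 1"
      using 3 \<mu> pi_less_4 by (intro mult_mono) auto
    then have "- (pi / 2) * \<mu> * W \<le> 2 + - (pi / 2) * \<mu>" by (simp add: algebra_simps)
    then have "W * exp (- (pi / 2) * \<mu> * W) \<le> 1 * exp (2 + - (pi / 2) * \<mu>)"
      using 3 by (intro mult_mono) auto
    then have "W * exp (- (pi / 2) * \<mu> * W) \<le> exp 2 * exp (- (pi / 2) * \<mu>)"
      by (simp only: exp_add mult_1)
    with 3 show ?thesis by (intro bound) auto
  next
    case 4
    \<comment> \<open>For W >= 1 the decay in W absorbs the prefactor, through W <= exp (W -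
      1).\<close>
    have "1 * 1 \<le> pi / 2 * \<mu>" using \<mu> pi_gt3 by (intro mult_mono) auto
    then have "1 * (W - 1) \<le> pi / 2 * \<mu> * (W - 1)" using 4 by (intro mult_right_mono) auto
    then have "exp (W - 1) \<le> exp (pi / 2 * \<mu> * (W - 1))" by simp
    then have "W \<le> exp (pi / 2 * \<mu> * (W - 1))"
      using exp_ge_add_one_self[of "W - 1"] by linarith
    then have "W * exp (- (pi / 2) * \<mu> * W)
                 \<le> exp (pi / 2 * \<mu> * (W - 1)) * exp (- (pi / 2) * \<mu> * W)"
      by (intro mult_right_mono) auto
    also have "\<dots> = 1 * exp (- (pi / 2) * \<mu>)" unfolding exp_add[symmetric] right_diff_distrib by simp
    also have "\<dots> \<le> exp 2 * exp (- (pi / 2) * \<mu>)" by (intro mult_right_mono) auto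
    finally show ?thesis using 4 by (intro bound) auto
  qed
qed

theorem theoremA1:
  "\<exists>C>0. \<forall>\<^sub>F \<mu> in at_top.
     0 < f\<^sub>0_per \<mu> - f\<^sub>0 \<mu> \<and> f\<^sub>0_per \<mu> - f\<^sub>0 \<mu> \<le> C * exp (- (pi / 2) * \<mu>)"
proof (intro exI conjI)
  show "0 < pi * exp 4 / 2" by simp
  \<comment> \<open>This is \<open>small\<close> multiplied by 2 \<mu>, so it holds
    eventually.\<close>
  have "((\<lambda>\<mu>. pi * exp 2 / 2 * exp (- (pi / 4) * \<mu>) * (2 * \<mu>)) \<longlongrightarrow> 0) at_top"
    by real_asymp
  then have "\<forall>\<^sub>F \<mu> in at_top. pi * exp 2 / 2 * exp (- (pi / 4) * \<mu>) * (2 * \<mu>) < 1"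
    by (rule order_tendstoD) simp
  then show "\<forall>\<^sub>F \<mu> in at_top.
     0 < f\<^sub>0_per \<mu> - f\<^sub>0 \<mu> \<and> f\<^sub>0_per \<mu> - f\<^sub>0 \<mu> \<le> pi * exp 4 / 2 * exp (- (pi / 2) * \<mu>)"
    using eventually_ge_at_top[of 8]
  proof eventually_elim
    fix \<mu> :: real
    assume "pi * exp 2 / 2 * exp (- (pi / 4) * \<mu>) * (2 * \<mu>) < 1" and \<mu>: "\<mu> \<ge> 8"
    then have small: "pi * exp 2 / 2 * exp (- (pi / 4) * \<mu>) \<le> 1 / (2 * \<mu>)"
      by (subst pos_le_divide_eq) auto
    have "\<mu> \<ge> 4" "\<mu> > 0" using \<mu> by auto
    then obtain W \<delta> where W: "W \<ge> 0" "\<delta> \<ge> 0" "f\<^sub>0 \<mu> = g\<^sub>0 \<mu> W \<delta>"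
      and min: "\<And>V \<epsilon>. V \<ge> 0 \<Longrightarrow> \<epsilon> \<ge> 0 \<Longrightarrow> f\<^sub>0 \<mu> \<le> g\<^sub>0 \<mu> V \<epsilon>"
      using f\<^sub>0_attained by blast
    obtain V \<epsilon> where "V \<ge> 0" "\<epsilon> \<ge> 0" "g\<^sub>0 \<mu> V \<epsilon> < f\<^sub>0_per \<mu>"
      using exists_g\<^sub>0_less_f\<^sub>0_per[OF \<open>\<mu> > 0\<close>] by blast
    then have "0 < f\<^sub>0_per \<mu> - f\<^sub>0 \<mu>" using min[of V \<epsilon>] by simp
    moreover have "f\<^sub>0_per \<mu> - f\<^sub>0 \<mu> \<le> pi * exp 4 / 2 * exp (- (pi / 2) * \<mu>)"
      unfolding W(3) by (rule f\<^sub>0_per_minus_g\<^sub>0_le[OF \<mu> small W(1,2)])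
    ultimately show "0 < f\<^sub>0_per \<mu> - f\<^sub>0 \<mu> \<and> f\<^sub>0_per \<mu> - f\<^sub>0 \<mu> \<le> pi * exp 4 / 2 * exp (- (pi / 2) * \<mu>)"
      by blast
  qed
qed

end
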